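(* Let $0<T_{\min}<T_{\max}$ and let $A\in\mathbb{R}^{n\times n}$, $B\in\mathbb{R}^{n\times m}$, $C\in\mathbb{R}^{q\times n}$, $A_J\in\mathbb{R}^{n\times n}$, $B_J\in\mathbb{R}^{n\times m_J}$, $C_J\in\mathbb{R}^{q_J\times n}$ be real matrices defining the impulsive open-loop system $$\begin{pmatrix}\dot x(t)\\ y(t)\end{pmatrix}=\begin{pmatrix}A&B\\ C&0\end{pmatrix}\begin{pmatrix}x(t)\\ u(t)\end{pmatrix},\qquad \begin{pmatrix}x(t_k)\\ y_J(k)\end{pmatrix}=\begin{pmatrix}A_J&B_J\\ C_J&0\end{pmatrix}\begin{pmatrix}x(t_k^-)\\ u_J(k)\end{pmatrix},\qquad t\ge 0,\ k\in\mathbb{N}.$$ There exists a dynamic output-feedback controller with constant system matrices (as defined in the context) for this system such that the S-variable stability LMIs (as defined in the context) are feasible for the corresponding closed-loop system if there exist some $\rho>0$, a continuously differentiable map $\mathbf{X}:[0,T_{\max}]\to\mathbb{S}^{2n}$ and real matrices $G,H,S,G_J,S_J\in\mathbb{R}^{n\times n}$ as well as $K,L,M,N,K_J,L_J,M_J,N_J$ (of sizes $n\times n$, $n\times q$, $m\times n$, $m\times q$, $n\times n$, $n\times q_J$, $m_J\times n$, $m_J\times q_J$, respectively) such that $$\mathbf{X}(\tau)\succ 0\quad\text{and}\quad\begin{pmatrix}\dot{\mathbf{X}}(\tau)+\mathbf{A}^T+\mathbf{A}&\mathbf{X}(\tau)+\rho\mathbf{A}^T-\mathbf{G}\\ \mathbf{X}(\tau)+\rho\mathbf{A}-\mathbf{G}^T&-\rho(\mathbf{G}+\mathbf{G}^T)\end{pmatrix}\prec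 0\qquad\text{for all }\tau\in[0,T_{\max}],$$ as well as $$\begin{pmatrix}-\mathbf{X}(\tau)&\mathbf{A}_J^T\\ \mathbf{A}_J&\mathbf{X}(0)-\mathbf{G}_J-\mathbf{G}_J^T\end{pmatrix}\prec 0\qquad\text{for all }\tau\in[T_{\min},T_{\max}].$$ Here $$\mathbf{G}:=\begin{pmatrix}H&I\\ S&G\end{pmatrix},\qquad \mathbf{G}_J:=\begin{pmatrix}H&I\\ S_J&G_J\end{pmatrix},$$ $$\mathbf{A}:=\begin{pmatrix}AH&A\\ 0&GA\end{pmatrix}+\begin{pmatrix}0&B\\ I&0\end{pmatrix}\begin{pmatrix}K&L\\ M&N\end{pmatrix}\begin{pmatrix}I&0\\ 0&C\end{pmatrix},$$ $$\mathbf{A}_J:=\begin{pmatrix}A_JH&A_J\\ 0&G_JA_J\end{pmatrix}+\begin{pmatrix}0&B_J\\ I&0\end{pmatrix}\begin{pmatrix}K_J&L_J\\ M_J&N_J\end{pmatrix}\begin{pmatrix}I&0\\ 0&C_J\end{pmatrix}.$$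
   Context: $\mathbb{S}^n$ is the set of symmetric real $n\times n$ matrices; $\succ 0$ and $\prec 0$ denote positive and negative definiteness of symmetric matrices; a dot over a matrix-valued map denotes its derivative. $f(t^-)$ denotes the limit from the left. Impulse instants are sequences $0=t_0<t_1<t_2<\dots$ with $t_k-t_{k-1}\in[T_{\min},T_{\max}]$ for all $k\in\mathbb{N}$. Dynamic output-feedback controller with constant system matrices: a system with some state dimension $n_c$ of the form $$\begin{pmatrix}\dot x_c(t)\\ u(t)\end{pmatrix}=\begin{pmatrix}A^c&B^c\\ C^c&D^c\end{pmatrix}\begin{pmatrix}x_c(t)\\ y(t)\end{pmatrix},\qquad \begin{pmatrix}x_c(t_k)\\ u_J(k)\end{pmatrix}=\begin{pmatrix}A_J^c&B_J^c\\ C_J^c&D_J^c\end{pmatrix}\begin{pmatrix}x_c(t_k^-)\\ y_J(k)\end{pmatrix}$$ for $t\ge 0$, $k\in\mathbb{N}$, with constant real matrices $A^c,B^c,C^c,D^c,A^c_J,B^c_J,C^c_J,D^c_J$. Closed-loop system: with $x_{cl}=\begin{pmatrix}x\\ x_c\end{pmatrix}$ it is $\dot x_{cl}(t)=\mathcal{A}x_{cl}(t)$, $x_{cl}(t_k)=\mathcal{A}_Jx_{cl}(t_k^-)$, where $$\mathcal{A}=\begin{pmatrix}A+BD^cC&BC^c\\ B^cC&A^c\end{pmatrix},\qquad \mathcal{A}_J=\begin{pmatrix}A_J+B_JD_J^cC_J&B_JC_J^c\\ B_J^cC_J&A_J^c\end{pmatrix}.$$ S-variable stability LMIs: they are feasible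 for the closed-loop system if there exist a continuously differentiable map $\mathcal{X}:[0,T_{\max}]\to\mathbb{S}^{n+n_c}$, a scalar $\rho>0$ and matrices $\mathcal{G},\mathcal{G}_J\in\mathbb{R}^{(n+n_c)\times(n+n_c)}$ with $\mathcal{X}(\tau)\succ 0$ and $$\begin{pmatrix}\dot{\mathcal{X}}(\tau)+\mathcal{A}^T\mathcal{G}^T+\mathcal{G}\mathcal{A}&\mathcal{X}(\tau)+\rho\mathcal{A}^T\mathcal{G}^T-\mathcal{G}\\ \mathcal{X}(\tau)+\rho\mathcal{G}\mathcal{A}-\mathcal{G}^T&-\rho(\mathcal{G}+\mathcal{G}^T)\end{pmatrix}\prec 0$$ for all $\tau\in[0,T_{\max}]$, and $$\begin{pmatrix}-\mathcal{X}(\tau)&\mathcal{A}_J^T\mathcal{G}_J^T\\ \mathcal{G}_J\mathcal{A}_J&\mathcal{X}(0)-\mathcal{G}_J-\mathcal{G}_J^T\end{pmatrix}\prec 0$$ for all $\tau\in[T_{\min},T_{\max}]$. *)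

theory Defs
  imports Complex_Main "Jordan_Normal_Form.Matrix"
begin

notation transpose_mat ("(_\<^sup>T)" [1000] 1000)

definition sym_mats :: "nat \<Rightarrow> real mat set" where
  "sym_mats n = {M \<in> carrier_mat n n. M\<^sup>T = M}"

definition pos_def :: "nat \<Rightarrow> real mat \<Rightarrow> bool" where
  "pos_def n M \<longleftrightarrow>
     M \<in> sym_mats n \<and> (\<forall>v \<in> carrier_vec n. v \<noteq> 0\<^sub>v n \<longrightarrow> v \<bullet> (M *\<^sub>v v) > 0)"

definition neg_def :: "nat \<Rightarrow> real mat \<Rightarrow> bool" where
  "neg_def n M \<longleftrightarrow>
     M \<in> sym_mats n \<and> (\<forall>v \<in> carrier_vec n. v \<noteq> 0\<^sub>v n \<longrightarrow> v \<bullet> (M *\<^sub>v v) < 0)"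

text \<open>
  \<open>C1_sym_map n T X X'\<close>: on \<open>[0,T]\<close>, \<open>X\<close> is a continuously differentiable map into the
  symmetric \<open>n \<times> n\<close> matrices with derivative \<open>X'\<close>. Matrices of dimension given by a number
  carry no topology in the library, so the derivative is taken entrywise; it is one-sided at the
  end points of the interval.
\<close>

definition C1_sym_map ::
    "nat \<Rightarrow> real \<Rightarrow> (real \<Rightarrow> real mat) \<Rightarrow> (real \<Rightarrow> real mat) \<Rightarrow> bool" where
  "C1_sym_map n T X X' \<longleftrightarrow>
     (\<forall>\<tau>\<in>{0..T}. X \<tau> \<in> sym_mats n \<and> X' \<tau> \<in> carrier_mat n n) \<and>
     (\<forall>i<n. \<forall>j<n.
        (\<forall>\<tau>\<in>{0..T}. ((\<lambda>s. X s $$ (i, j)) has_real_derivative X' \<tau> $$ (i, j))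
                        (at \<tau> within {0..T})) \<and>
        continuous_on {0..T} (\<lambda>\<tau>. X' \<tau> $$ (i, j)))"

text \<open>
  System matrices of a controller with state dimension \<open>nc\<close>: the continuous part maps \<open>(xc, y)\<close>
  to \<open>(xc', u)\<close>, with \<open>y\<close> of dimension \<open>q\<close> and \<open>u\<close> of dimension \<open>m\<close>. The impulsive part has
  the same shape, mapping \<open>(xc(t\<^sub>k-), yJ(k))\<close> to \<open>(xc(t\<^sub>k), uJ(k))\<close>.
\<close>

definition controller_mats ::
    "nat \<Rightarrow> nat \<Rightarrow> nat \<Rightarrow> real mat \<Rightarrow> real mat \<Rightarrow> real mat \<Rightarrow> real mat \<Rightarrow> bool" where
  "controller_mats nc q m Ac Bc Cc Dc \<longleftrightarrow>
     Ac \<in> carrier_mat nc nc \<and> Bc \<in> carrier_mat nc q \<and>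
     Cc \<in> carrier_mat m nc \<and> Dc \<in> carrier_mat m q"

definition closed_loop_mat ::
    "real mat \<Rightarrow> real mat \<Rightarrow> real mat \<Rightarrow> real mat \<Rightarrow> real mat \<Rightarrow> real mat \<Rightarrow> real mat \<Rightarrow> real mat" where
  "closed_loop_mat A B C Ac Bc Cc Dc =
     four_block_mat (A + B * Dc * C) (B * Cc)
                    (Bc * C)         Ac"

text \<open>
  Eliminating \<open>y\<close> and \<open>u\<close> from the interconnection of plant and controller gives the closed-loop
  matrix.
\<close>

lemma closed_loop_mat_interconnection:
  assumes "A \<in> carrier_mat n n" "B \<in> carrier_mat n m" "C \<in> carrier_mat q n"
    and "controller_mats nc q m Ac Bc Cc Dc"
    and "x \<in> carrier_vec n" "xc \<in> carrier_vec nc"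
    and y: "y = C *\<^sub>v x" and u: "u = Cc *\<^sub>v xc + Dc *\<^sub>v y"
  shows "closed_loop_mat A B C Ac Bc Cc Dc *\<^sub>v (x @\<^sub>v xc)
         = (A *\<^sub>v x + B *\<^sub>v u) @\<^sub>v (Ac *\<^sub>v xc + Bc *\<^sub>v y)"
proof -
  have K: "Ac \<in> carrier_mat nc nc" "Bc \<in> carrier_mat nc q"
    "Cc \<in> carrier_mat m nc" "Dc \<in> carrier_mat m q"
    using assms(4) by (auto simp: controller_mats_def)
  have c: "A *\<^sub>v x \<in> carrier_vec n" "Cc *\<^sub>v xc \<in> carrier_vec m" "Dc *\<^sub>v y \<in> carrier_vec m"
    "B *\<^sub>v (Cc *\<^sub>v xc) \<in> carrier_vec n" "B *\<^sub>v (Dc *\<^sub>v y) \<in> carrier_vec n"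
    "Bc *\<^sub>v y \<in> carrier_vec nc" "Ac *\<^sub>v xc \<in> carrier_vec nc"
    using assms K by auto
  have BDC: "B * Dc * C \<in> carrier_mat n n" "B * Cc \<in> carrier_mat n nc"
      "Bc * C \<in> carrier_mat nc n"
    using assms K by auto
  have 1: "(B * Dc * C) *\<^sub>v x = B *\<^sub>v (Dc *\<^sub>v y)"
    using assoc_mult_mat_vec[of "B * Dc" n q C n x] assoc_mult_mat_vec[of B n m Dc q y] assms K
    by simp
  have "closed_loop_mat A B C Ac Bc Cc Dc *\<^sub>v (x @\<^sub>v xc)
      = ((A + B * Dc * C) *\<^sub>v x + (B * Cc) *\<^sub>v xc) @\<^sub>v ((Bc * C) *\<^sub>v x + Ac *\<^sub>v xc)"
    unfolding closed_loop_mat_def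
    by (rule four_block_mat_mult_vec[of _ n n _ nc _ nc]) (use assms K BDC in auto)
  also have "(A + B * Dc * C) *\<^sub>v x = A *\<^sub>v x + B *\<^sub>v (Dc *\<^sub>v y)"
    using add_mult_distrib_mat_vec[of A n n "B * Dc * C" x] assms(1,5) BDC 1 by simp
  also have "(B * Cc) *\<^sub>v xc = B *\<^sub>v (Cc *\<^sub>v xc)"
    using assms K by (simp add: assoc_mult_mat_vec)
  also have "(Bc * C) *\<^sub>v x = Bc *\<^sub>v y"
    using assms K by (simp add: assoc_mult_mat_vec)
  also have "A *\<^sub>v x + B *\<^sub>v (Dc *\<^sub>v y) + B *\<^sub>v (Cc *\<^sub>v xc) = A *\<^sub>v x + B *\<^sub>v u"
    unfolding u using c assms(2) comm_add_vec[OF c(4,5)]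
    by (simp add: mult_add_distrib_mat_vec[of B n m] assoc_add_vec[of _ n])
  also have "Bc *\<^sub>v y + Ac *\<^sub>v xc = Ac *\<^sub>v xc + Bc *\<^sub>v y"
    using comm_add_vec[OF c(6,7)] .
  finally show ?thesis .
qed

text \<open>
  Feasibility of the S-variable LMIs for the impulsive system \<open>x' = A x\<close>,
  \<open>x(t\<^sub>k) = AJ x(t\<^sub>k-)\<close> of dimension \<open>N\<close> with dwell times in \<open>[Tmin, Tmax]\<close>.
\<close>

definition S_variable_LMIs_feasible ::
    "nat \<Rightarrow> real \<Rightarrow> real \<Rightarrow> real mat \<Rightarrow> real mat \<Rightarrow> bool" where
  "S_variable_LMIs_feasible N Tmin Tmax A AJ \<longleftrightarrow>
     (\<exists>X X' \<rho> G GJ.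
        C1_sym_map N Tmax X X' \<and> \<rho> > 0 \<and>
        G \<in> carrier_mat N N \<and> GJ \<in> carrier_mat N N \<and>
        (\<forall>\<tau>\<in>{0..Tmax}. pos_def N (X \<tau>) \<and>
           neg_def (N + N)
             (four_block_mat
                (X' \<tau> + A\<^sup>T * G\<^sup>T + G * A)            (X \<tau> + \<rho> \<cdot>\<^sub>m (A\<^sup>T * G\<^sup>T) - G)
                (X \<tau> + \<rho> \<cdot>\<^sub>m (G * A) - G\<^sup>T)   (- (\<rho> \<cdot>\<^sub>m (G + G\<^sup>T))))) \<and>
        (\<forall>\<tau>\<in>{Tmin..Tmax}.
           neg_def (N + N)
             (four_block_mat
                (- X \<tau>)    (AJ\<^sup>T * GJ\<^sup>T)
                (GJ * AJ)  (X 0 - GJ - GJ\<^sup>T))))"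

definition synth_G :: "nat \<Rightarrow> real mat \<Rightarrow> real mat \<Rightarrow> real mat \<Rightarrow> real mat" where
  "synth_G n H S G = four_block_mat H (1\<^sub>m n) S G"

text \<open>
  Dimensions: \<open>n\<close> states, \<open>m\<close> inputs, \<open>q\<close> outputs. The middle factor of the product has size
  \<open>(n + m) \<times> (n + q)\<close>.
\<close>

definition synth_A ::
    "nat \<Rightarrow> nat \<Rightarrow> nat \<Rightarrow> real mat \<Rightarrow> real mat \<Rightarrow> real mat \<Rightarrow> real mat \<Rightarrow> real mat \<Rightarrow>
     real mat \<Rightarrow> real mat \<Rightarrow> real mat \<Rightarrow> real mat \<Rightarrow> real mat" where
  "synth_A n m q A B C H G K L M N =
     four_block_mat (A * H) A (0\<^sub>m n n) (G * A) +
     four_block_mat (0\<^sub>m n n) B (1\<^sub>m n) (0\<^sub>m n m) *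
       four_block_mat K L M N *
       four_block_mat (1\<^sub>m n) (0\<^sub>m n n) (0\<^sub>m q n) C"

end

theory Submission
  imports Defs "Jordan_Normal_Form.Determinant"
begin

text \<open>
  With \<open>n\<close> controller states, let \<open>P\<close> be the inverse of \<open>Y = (H, I; I, 0)\<close>. Congruence with
  \<open>diag(P, P)\<close> turns the synthesis LMIs into the S-variable LMIs for the Lyapunov map
  \<open>P\<^sup>T X P\<close> and the slack matrix \<open>P\<^sup>T bG P\<close>, provided that the closed-loop matrix solves
  \<open>bG P Acl = bA P\<close>. Since \<open>bG P = (I, 0; G, V)\<close> with \<open>V = S - G H\<close>, this equation can be
  solved block by block for the controller matrices as soon as \<open>V\<close> is invertible. A kernel vector
  \<open>u\<close> of \<open>V\<close> gives the kernel vector \<open>(u, - H u)\<close> of \<open>bG\<close>, whereas the lower right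
  blocks of the LMIs make \<open>bG\<close> nonsingular. The flow and jump conditions share \<open>H\<close> and hence
  \<open>P\<close>, so that both are transformed by the same congruence.
\<close>

section \<open>Matrix identities and inverses\<close>

text \<open>With premises on \<open>dim_row\<close> and \<open>dim_col\<close>, every variable of
  the rule occurs in its conclusion, so it works as a conditional rewrite rule. The two lemmas on
  distributivity and scalar factors have this form for the same reason.\<close>

lemma mat_assoc_dim:
  fixes A B C :: "'a :: semiring_0 mat"
  assumes "dim_col A = dim_row B" "dim_col B = dim_row C"
  shows "A * B * C = A * (B * C)"
  by (rule assoc_mult_mat[of _ "dim_row A" "dim_col A" _ "dim_col B" _ "dim_col C"])
    (use assms in auto)

lemma mat_distrib_dim:
  fixes A B C D :: "'a :: ring mat"
  assumes "dim_row A = dim_row B" "dim_col A = dim_col B"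
  shows "dim_col A = dim_row C \<Longrightarrow> (A + B) * C = A * C + B * C"
    and "dim_col A = dim_row C \<Longrightarrow> (A - B) * C = A * C - B * C"
    and "dim_col D = dim_row A \<Longrightarrow> D * (A + B) = D * A + D * B"
    and "dim_col D = dim_row A \<Longrightarrow> D * (A - B) = D * A - D * B"
  using assms
  by (auto intro!: add_mult_distrib_mat[of _ "dim_row A" "dim_col A" _ _ "dim_col C"]
      minus_mult_distrib_mat[of _ "dim_row A" "dim_col A" _ _ "dim_col C"]
      mult_add_distrib_mat[of _ "dim_row D" "dim_col D" _ "dim_col A"]
      mult_minus_distrib_mat[of _ "dim_row D" "dim_col D" _ "dim_col A"])

lemma smult_mult_dim:
  fixes A B :: "'a :: comm_semiring_0 mat"
  assumes "dim_col A = dim_row B"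
  shows "(k \<cdot>\<^sub>m A) * B = k \<cdot>\<^sub>m (A * B)" and "A * (k \<cdot>\<^sub>m B) = k \<cdot>\<^sub>m (A * B)"
  by (rule mult_smult_assoc_mat[of _ "dim_row A" "dim_col A" _ "dim_col B"]
      mult_smult_distrib[of _ "dim_row A" "dim_col A" _ "dim_col B"]; use assms in auto)+

lemma smult_mult_mat_vec:
  fixes A :: "'a :: comm_semiring_0 mat"
  assumes "A \<in> carrier_mat nr nc" "v \<in> carrier_vec nc"
  shows "(k \<cdot>\<^sub>m A) *\<^sub>v v = k \<cdot>\<^sub>v (A *\<^sub>v v)"
  using assms by (intro eq_vecI) (auto simp: scalar_prod_def sum_distrib_left mult.assoc)

text \<open>A trivial kernel makes the determinant nonzero, hence the matrix a unit of the matrix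
  ring. The right inverse \<open>W\<close> is what solves equations \<open>V * Z = R\<close> for
  \<open>Z\<close>.\<close>

lemma mat_inverse_exists:
  fixes V :: "'a :: field mat"
  assumes V: "V \<in> carrier_mat n n"
    and inj: "\<And>u. u \<in> carrier_vec n \<Longrightarrow> V *\<^sub>v u = 0\<^sub>v n \<Longrightarrow> u = 0\<^sub>v n"
  obtains W where "W \<in> carrier_mat n n" "V * W = 1\<^sub>m n"
proof -
  have "det V \<noteq> 0"
    using det_0_iff_vec_prod_zero_field[OF V] inj by blast
  \<comment> \<open>The argument \<open>()\<close> fills the extension slot of the record
    \<open>ring_mat\<close>.\<close>
  from det_non_zero_imp_unit[OF V this, of "()"] show ?thesis
    using that by (auto simp: Units_def ring_mat_def)
qed


subsection \<open>Congruence transformations\<close>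

definition congruence :: "real mat \<Rightarrow> real mat \<Rightarrow> real mat" where
  "congruence P M = P\<^sup>T * M * P"

lemma congruence_carrier [simp]:
  "P \<in> carrier_mat n n \<Longrightarrow> M \<in> carrier_mat n n \<Longrightarrow> congruence P M \<in> carrier_mat n n"
  by (simp add: congruence_def)

lemma congruence_simps:
  assumes P: "P \<in> carrier_mat n n" and M: "M \<in> carrier_mat n n" and R: "R \<in> carrier_mat n n"
  shows "congruence P (M + R) = congruence P M + congruence P R"
    and "congruence P (M - R) = congruence P M - congruence P R"
    and "congruence P (- M) = - congruence P M"
    and "congruence P (k \<cdot>\<^sub>m M) = k \<cdot>\<^sub>m congruence P M"
    and "congruence P M\<^sup>T = (congruence P M)\<^sup>T"
proof -
  show "congruence P M\<^sup>T = (congruence P M)\<^sup>T"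
    using P M by (simp add: congruence_def mat_assoc_dim transpose_mult[of _ n n _ n])
qed (use P M R in \<open>simp_all add: congruence_def mat_distrib_dim smult_mult_dim\<close>)

lemma congruence_quadratic_form:
  assumes P: "P \<in> carrier_mat n n" and M: "M \<in> carrier_mat n n" and v: "v \<in> carrier_vec n"
  shows "v \<bullet> (congruence P M *\<^sub>v v) = (P *\<^sub>v v) \<bullet> (M *\<^sub>v (P *\<^sub>v v))"
proof -
  have "congruence P M *\<^sub>v v = P\<^sup>T *\<^sub>v (M *\<^sub>v (P *\<^sub>v v))"
    using P M v by (simp add: congruence_def assoc_mult_mat_vec[of _ n n _ n])
  then show ?thesis
    using transpose_vec_mult_scalar[of P n n v "M *\<^sub>v (P *\<^sub>v v)"] P M v
      comm_scalar_prod[of v n "congruence P M *\<^sub>v v"]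
      comm_scalar_prod[of "P *\<^sub>v v" n "M *\<^sub>v (P *\<^sub>v v)"]
    by simp
qed

lemma congruence_sym_mats:
  assumes "P \<in> carrier_mat n n" "M \<in> sym_mats n"
  shows "congruence P M \<in> sym_mats n"
  using assms congruence_simps(5)[of P n M M] by (auto simp: sym_mats_def)

lemma left_invertible_nonzero:
  fixes P Q :: "'a :: semiring_1 mat"
  assumes "P \<in> carrier_mat n n" "Q \<in> carrier_mat n n" "Q * P = 1\<^sub>m n"
    and "v \<in> carrier_vec n" "v \<noteq> 0\<^sub>v n"
  shows "P *\<^sub>v v \<noteq> 0\<^sub>v n"
proof
  assume "P *\<^sub>v v = 0\<^sub>v n"
  moreover have "Q * P *\<^sub>v v = Q *\<^sub>v (P *\<^sub>v v)"
    using assms(2,1,4) by (rule assoc_mult_mat_vec)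
  ultimately have "Q * P *\<^sub>v v = 0\<^sub>v n" using assms(2) by auto
  then show False using assms by simp
qed

text \<open>Evaluating the new form at \<open>v\<close> means evaluating the old one at
  \<open>P *\<^sub>v v\<close>. The left inverse \<open>Q\<close> keeps this vector nonzero, so the
  strict inequality survives.\<close>

lemma pos_def_congruence:
  assumes "P \<in> carrier_mat n n" "Q \<in> carrier_mat n n" "Q * P = 1\<^sub>m n" and "pos_def n M"
  shows "pos_def n (congruence P M)"
  using assms left_invertible_nonzero[OF assms(1-3)] congruence_sym_mats[OF assms(1), of M]
  by (auto simp: pos_def_def congruence_quadratic_form sym_mats_def)

lemma neg_def_congruence:
  assumes "P \<in> carrier_mat n n" "Q \<in> carrier_mat n n" "Q * P = 1\<^sub>m n" and "neg_def n M"
  shows "neg_def n (congruence P M)"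
  using assms left_invertible_nonzero[OF assms(1-3)] congruence_sym_mats[OF assms(1), of M]
  by (auto simp: neg_def_def congruence_quadratic_form sym_mats_def)

text \<open>The congruence with diag(P, P), whose left inverse is diag(Q, Q), acts on each block
  separately.\<close>

lemma neg_def_block_congruence:
  assumes P: "P \<in> carrier_mat n n" and Q: "Q \<in> carrier_mat n n" and QP: "Q * P = 1\<^sub>m n"
    and M: "M1 \<in> carrier_mat n n" "M2 \<in> carrier_mat n n"
      "M3 \<in> carrier_mat n n" "M4 \<in> carrier_mat n n"
    and neg: "neg_def (n + n) (four_block_mat M1 M2 M3 M4)"
  shows "neg_def (n + n) (four_block_mat (congruence P M1) (congruence P M2)
           (congruence P M3) (congruence P M4))"
proof -
  let ?D = "\<lambda>P. four_block_mat P (0\<^sub>m n n) (0\<^sub>m n n) P :: real mat"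
  have "?D Q * ?D P = 1\<^sub>m (n + n)"
    using P Q QP by (simp add: mult_four_block_mat[of _ n n _ n _ n _ _ n _ n])
  then have "neg_def (n + n) (congruence (?D P) (four_block_mat M1 M2 M3 M4))"
    by (intro neg_def_congruence[of _ _ "?D Q"]) (use P Q neg in auto)
  also have "congruence (?D P) (four_block_mat M1 M2 M3 M4)
      = four_block_mat (congruence P M1) (congruence P M2) (congruence P M3) (congruence P M4)"
    using P M
    by (simp add: congruence_def transpose_four_block_mat[of _ n n _ n _ n]
        mult_four_block_mat[of _ n n _ n _ n _ _ n _ n])
  finally show ?thesis .
qed

text \<open>The quadratic form is restricted to vectors (0, v). This extracts from each LMI the
  condition on its slack matrix alone.\<close>

lemma neg_def_lower_right_block:
  assumes neg: "neg_def (k + l) (four_block_mat M1 M2 M3 M4)"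
    and M: "M1 \<in> carrier_mat k k" "M2 \<in> carrier_mat k l"
      "M3 \<in> carrier_mat l k" "M4 \<in> carrier_mat l l"
    and v: "v \<in> carrier_vec l" "v \<noteq> 0\<^sub>v l"
  shows "v \<bullet> (M4 *\<^sub>v v) < 0"
proof -
  let ?w = "0\<^sub>v k @\<^sub>v v"
  have "0\<^sub>v (k + l) = 0\<^sub>v k @\<^sub>v (0\<^sub>v l :: real vec)" by auto
  then have "?w \<noteq> 0\<^sub>v (k + l)"
    using v append_vec_eq[of "0\<^sub>v k" k "0\<^sub>v k" v "0\<^sub>v l"] by simp
  moreover have "?w \<in> carrier_vec (k + l)" using v by simp
  ultimately have "?w \<bullet> (four_block_mat M1 M2 M3 M4 *\<^sub>v ?w) < 0"
    using neg by (auto simp: neg_def_def)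
  moreover have "four_block_mat M1 M2 M3 M4 *\<^sub>v ?w
      = (M1 *\<^sub>v 0\<^sub>v k + M2 *\<^sub>v v) @\<^sub>v (M3 *\<^sub>v 0\<^sub>v k + M4 *\<^sub>v v)"
    using M v by (intro four_block_mat_mult_vec) auto
  moreover have "M3 *\<^sub>v 0\<^sub>v k + M4 *\<^sub>v v = M4 *\<^sub>v v"
    using M v by auto
  moreover have "?w \<bullet> ((M1 *\<^sub>v 0\<^sub>v k + M2 *\<^sub>v v) @\<^sub>v (M4 *\<^sub>v v)) = v \<bullet> (M4 *\<^sub>v v)"
    using M v by (subst scalar_prod_append[of _ k _ l]) auto
  ultimately show ?thesis by simp
qed

text \<open>Each entry is a finite linear combination of entries of \<open>M\<close> with
  coefficients from \<open>P\<close>. For constant \<open>P\<close>, derivatives and continuity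
  therefore pass through it.\<close>

lemma congruence_index:
  assumes "P \<in> carrier_mat n n" "M \<in> carrier_mat n n" "i < n" "j < n"
  shows "congruence P M $$ (i, j) = (\<Sum>k<n. P $$ (k, i) * (\<Sum>l<n. M $$ (k, l) * P $$ (l, j)))"
  using assms by (simp add: congruence_def scalar_prod_def atLeast0LessThan)

lemma C1_sym_map_congruence:
  assumes X: "C1_sym_map n T X X'" and P: "P \<in> carrier_mat n n"
  shows "C1_sym_map n T (\<lambda>\<tau>. congruence P (X \<tau>)) (\<lambda>\<tau>. congruence P (X' \<tau>))"
  unfolding C1_sym_map_def
proof (intro conjI ballI allI impI)
  have Xc: "X \<tau> \<in> carrier_mat n n" "X' \<tau> \<in> carrier_mat n n" "X \<tau> \<in> sym_mats n"
    if "\<tau> \<in> {0..T}" for \<tau>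
    using X that by (auto simp: C1_sym_map_def sym_mats_def)
  show "congruence P (X \<tau>) \<in> sym_mats n" "congruence P (X' \<tau>) \<in> carrier_mat n n"
    if "\<tau> \<in> {0..T}" for \<tau>
    using Xc[OF that] P by (auto intro: congruence_sym_mats)
  fix i j assume ij: "i < n" "j < n"
  have "continuous_on {0..T}
      (\<lambda>\<tau>. \<Sum>k<n. P $$ (k, i) * (\<Sum>l<n. X' \<tau> $$ (k, l) * P $$ (l, j)))"
    using X by (intro continuous_intros) (auto simp: C1_sym_map_def)
  then show "continuous_on {0..T} (\<lambda>\<tau>. congruence P (X' \<tau>) $$ (i, j))"
    by (subst continuous_on_cong[OF refl congruence_index[OF P Xc(2) ij]])
  fix \<tau> assume \<tau>: "\<tau> \<in> {0..T}"
  have "((\<lambda>s. \<Sum>k<n. P $$ (k, i) * (\<Sum>l<n. X s $$ (k, l) * P $$ (l, j))) has_real_derivative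
      (\<Sum>k<n. P $$ (k, i) * (\<Sum>l<n. X' \<tau> $$ (k, l) * P $$ (l, j)))) (at \<tau> within {0..T})"
    using X \<tau> by (intro DERIV_sum DERIV_cmult_right DERIV_cmult) (auto simp: C1_sym_map_def)
  then have "((\<lambda>s. \<Sum>k<n. P $$ (k, i) * (\<Sum>l<n. X s $$ (k, l) * P $$ (l, j))) has_real_derivative
      congruence P (X' \<tau>) $$ (i, j)) (at \<tau> within {0..T})"
    by (simp only: congruence_index[OF P Xc(2)[OF \<tau>] ij])
  \<comment> \<open>The entry formula is available only where \<open>X s\<close> is known to be
    square, that is on \<open>{0..T}\<close>. Both functions agree on this whole interval, so any
    positive radius \<open>d\<close> will do.\<close>
  then show "((\<lambda>s. congruence P (X s) $$ (i, j)) has_real_derivative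
      congruence P (X' \<tau>) $$ (i, j)) (at \<tau> within {0..T})"
    by (rule has_field_derivative_transform_within[where d = 1])
      (use \<tau> congruence_index[OF P Xc(1) ij] in auto)
qed


subsection \<open>Recovering the controller\<close>

text \<open>Multiplied out, each of \<open>K\<close>, \<open>L\<close>, \<open>M\<close>,
  \<open>N\<close> enters exactly one block, which allows the block comparison used to find the
  controller.\<close>

lemma synth_A_eq:
  assumes "A \<in> carrier_mat n n" "B \<in> carrier_mat n m" "C \<in> carrier_mat q n"
    and "G \<in> carrier_mat n n" "H \<in> carrier_mat n n"
    and "K \<in> carrier_mat n n" "L \<in> carrier_mat n q" "M \<in> carrier_mat m n" "N \<in> carrier_mat m q"
  shows "synth_A n m q A B C H G K L M N
    = four_block_mat (A * H + B * M) (A + B * (N * C)) K (G * A + L * C)"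
  using assms
  by (simp add: synth_A_def mult_four_block_mat[of _ n n _ m _ n _ _ n _ q]
      mult_four_block_mat[of _ n n _ q _ n _ _ n _ n]
      add_four_block_mat[of _ n n _ n _ n] mat_assoc_dim)

text \<open>The matrix P = Y^(-1) in closed form; this inverse exists for every
  \<open>H\<close>.\<close>

definition slack_transform :: "nat \<Rightarrow> real mat \<Rightarrow> real mat" where
  "slack_transform n H = four_block_mat (0\<^sub>m n n) (1\<^sub>m n) (1\<^sub>m n) (- H)"

lemma slack_transform_carrier [simp]:
  "H \<in> carrier_mat n n \<Longrightarrow> slack_transform n H \<in> carrier_mat (n + n) (n + n)"
  by (simp add: slack_transform_def)

lemma slack_transform_left_inverse:
  assumes H: "H \<in> carrier_mat n n"
  shows "four_block_mat H (1\<^sub>m n) (1\<^sub>m n) (0\<^sub>m n n) * slack_transform n H = 1\<^sub>m (n + n)"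
proof -
  have "H + - H = 0\<^sub>m n n" "1\<^sub>m n + - 0\<^sub>m n n = (1\<^sub>m n :: real mat)"
    using H by (auto intro!: eq_matI)
  then show ?thesis
    using H by (simp add: slack_transform_def mult_four_block_mat[of _ n n _ n _ n _ _ n _ n])
qed

text \<open>After cancelling P^T, the blocks of bG P Acl = bA P are solved in turn: upper left by
  \<open>N\<close> as feedthrough, upper right by \<open>Cc\<close>, lower left by \<open>Bc\<close>
  and lower right by \<open>Ac\<close>. The last two divide by \<open>V\<close>. Flow and jump are
  both instances.\<close>

lemma controller_reconstruction:
  assumes plant: "A \<in> carrier_mat n n" "B \<in> carrier_mat n m" "C \<in> carrier_mat q n"
    and GHS: "G \<in> carrier_mat n n" "H \<in> carrier_mat n n" "S \<in> carrier_mat n n"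
    and KLMN: "K \<in> carrier_mat n n" "L \<in> carrier_mat n q"
      "M \<in> carrier_mat m n" "N \<in> carrier_mat m q"
    and nonzero: "\<And>w. w \<in> carrier_vec (n + n) \<Longrightarrow> w \<noteq> 0\<^sub>v (n + n) \<Longrightarrow>
      synth_G n H S G *\<^sub>v w \<noteq> 0\<^sub>v (n + n)"
  obtains Ac Bc Cc Dc where "controller_mats n q m Ac Bc Cc Dc"
    and "congruence (slack_transform n H) (synth_G n H S G) * closed_loop_mat A B C Ac Bc Cc Dc
      = congruence (slack_transform n H) (synth_A n m q A B C H G K L M N)"
proof -
  define V where "V = S - G * H"
  have V: "V \<in> carrier_mat n n" using GHS by (intro carrier_matI) (auto simp: V_def)
  have "u = 0\<^sub>v n" if u: "u \<in> carrier_vec n" and Vu: "V *\<^sub>v u = 0\<^sub>v n" for u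
  proof (rule ccontr)
    assume "u \<noteq> 0\<^sub>v n"
    have zero: "0\<^sub>v (n + n) = 0\<^sub>v n @\<^sub>v (0\<^sub>v n :: real vec)" by auto
    \<comment> \<open>This is P applied to (0, u), so its image under bG is the second block column
      of bG P applied to \<open>u\<close>, namely (0, V u).\<close>
    let ?w = "u @\<^sub>v - (H *\<^sub>v u)"
    have "synth_G n H S G *\<^sub>v ?w = (H *\<^sub>v u + - (H *\<^sub>v u)) @\<^sub>v (S *\<^sub>v u + G *\<^sub>v (- (H *\<^sub>v u)))"
      unfolding synth_G_def using GHS u
      by (subst four_block_mat_mult_vec[of _ n n _ n _ n]) auto
    also have "H *\<^sub>v u + - (H *\<^sub>v u) = 0\<^sub>v n"
      using GHS u by (intro eq_vecI) auto
    also have "S *\<^sub>v u + G *\<^sub>v (- (H *\<^sub>v u)) = V *\<^sub>v u"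
    proof -
      have "G *\<^sub>v (- (H *\<^sub>v u)) = - (G * H *\<^sub>v u)"
        using GHS u by (intro eq_vecI) (auto simp: assoc_mult_mat_vec[of _ n n _ n])
      moreover have "V *\<^sub>v u = S *\<^sub>v u - G * H *\<^sub>v u"
        unfolding V_def using GHS u by (intro minus_mult_distrib_mat_vec) auto
      ultimately show ?thesis using GHS u by (intro eq_vecI) auto
    qed
    finally have "synth_G n H S G *\<^sub>v ?w = 0\<^sub>v (n + n)"
      using Vu zero by simp
    moreover have "?w \<noteq> 0\<^sub>v (n + n)" using \<open>u \<noteq> 0\<^sub>v n\<close> u zero by simp
    ultimately show False using nonzero[of ?w] GHS u by auto
  qed
  with V obtain W where W: "W \<in> carrier_mat n n" "V * W = 1\<^sub>m n"
    by (rule mat_inverse_exists)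
  have VW: "V * (W * R) = R" if "R \<in> carrier_mat n k" for R k
    using that V W by (simp flip: assoc_mult_mat[of _ n n _ n _ k])
  \<comment> \<open>The upper right block requires B Cc = B (M - N C H), and the lower left one V Bc
    C = (L - G B N) C. Dropping the outer factors \<open>B\<close> and \<open>C\<close> gives
    sufficient equations. \<open>Ac\<close> comes last because its block contains
    \<open>Cc\<close>.\<close>
  define Cc where "Cc = M - N * (C * H)"
  define Bc where "Bc = W * (L - G * (B * N))"
  define Ac where "Ac = W * (K - (G * A + L * C) * H - G * (B * Cc))"
  have ctrl: "Cc \<in> carrier_mat m n" "Bc \<in> carrier_mat n q" "Ac \<in> carrier_mat n n"
    using assms W by (auto simp: Cc_def Bc_def Ac_def intro!: carrier_matI)
  have VB: "V * Bc = L - G * (B * N)"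
    unfolding Bc_def by (rule VW) (use assms in auto)
  have VA: "V * Ac = K - (G * A + L * C) * H - G * (B * Cc)"
    unfolding Ac_def by (rule VW) (use assms ctrl in auto)
  have VBC: "V * (Bc * C) = (L - G * (B * N)) * C"
    unfolding VB[symmetric] using assms V ctrl by (simp add: mat_assoc_dim)
  let ?P = "slack_transform n H" and ?G = "synth_G n H S G"
  let ?Acl = "closed_loop_mat A B C Ac Bc Cc N"
  let ?A = "synth_A n m q A B C H G K L M N"
  have "H + - H = 0\<^sub>m n n"
    using GHS by (intro eq_matI) auto
  moreover have "S + - (G * H) = V"
    using GHS by (simp add: V_def minus_add_uminus_mat[of _ n n])
  ultimately have GP: "?G * ?P = four_block_mat (1\<^sub>m n) (0\<^sub>m n n) G V"
    using GHS
    by (simp add: synth_G_def slack_transform_def mult_four_block_mat[of _ n n _ n _ n _ _ n _ n])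
  have "?G * ?P * ?Acl = four_block_mat (A + B * (N * C)) (B * Cc)
      (G * (A + B * (N * C)) + V * (Bc * C)) (G * (B * Cc) + V * Ac)"
    unfolding GP closed_loop_mat_def using assms V ctrl
    by (simp add: mult_four_block_mat[of _ n n _ n _ n _ _ n _ n] mat_assoc_dim)
  also have "\<dots> = four_block_mat (A + B * (N * C)) (A * H + B * M - (A + B * (N * C)) * H)
      (G * A + L * C) (K - (G * A + L * C) * H)"
  proof (intro arg_cong4[where f = four_block_mat] refl)
    \<comment> \<open>Once products are expanded, only additive cancellation is left. It is checked
      entry by entry, with \<open>index_mult_mat(1)\<close> removed so that entries of products stay
      atomic.\<close>
    show "B * Cc = A * H + B * M - (A + B * (N * C)) * H"
      unfolding Cc_def using assms
      by (simp add: mat_distrib_dim mat_assoc_dim)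
        (intro eq_matI, auto simp del: index_mult_mat(1))
    show "G * (A + B * (N * C)) + V * (Bc * C) = G * A + L * C"
      unfolding VBC using assms
      by (simp add: mat_distrib_dim mat_assoc_dim)
        (intro eq_matI, auto simp del: index_mult_mat(1))
    show "G * (B * Cc) + V * Ac = K - (G * A + L * C) * H"
      unfolding VA using assms ctrl
      by (intro eq_matI) (auto simp del: index_mult_mat(1))
  qed
  also have "\<dots> = ?A * ?P"
    unfolding synth_A_eq[OF plant GHS(1,2) KLMN] slack_transform_def
    using mult_carrier_mat[of "A + B * (N * C)" n n H n] mult_carrier_mat[of "G * A + L * C" n n H n]
       assms minus_add_uminus_mat[of "A * H + B * M" n n "(A + B * (N * C)) * H"]
      minus_add_uminus_mat[of K n n "(G * A + L * C) * H"]
    by (simp add: mult_four_block_mat[of _ n n _ n _ n _ _ n _ n])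
  finally have "?G * ?P * ?Acl = ?A * ?P" .
  moreover have "?G \<in> carrier_mat (n + n) (n + n)" "?A \<in> carrier_mat (n + n) (n + n)"
    "?Acl \<in> carrier_mat (n + n) (n + n)" "?P \<in> carrier_mat (n + n) (n + n)"
    using assms ctrl by (auto simp: synth_G_def synth_A_eq closed_loop_mat_def)
  ultimately have "congruence ?P ?G * ?Acl = congruence ?P ?A"
    by (simp add: congruence_def mat_assoc_dim)
  then show ?thesis
    using assms ctrl by (intro that[of Ac Bc Cc N]) (auto simp: controller_mats_def)
qed

section \<open>From the synthesis LMIs to the closed-loop LMIs\<close>

theorem theorem6:
  fixes n m q mJ qJ :: nat
    and Tmin Tmax \<rho> :: real
    and A B C AJ BJ CJ :: "real mat"
    and X X' :: "real \<Rightarrow> real mat"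
    and G H S GJ SJ K L M N KJ LJ MJ NJ :: "real mat"
  assumes T: "0 < Tmin" "Tmin < Tmax"
    and n: "0 < n"
    and plant: "A \<in> carrier_mat n n" "B \<in> carrier_mat n m" "C \<in> carrier_mat q n"
      "AJ \<in> carrier_mat n n" "BJ \<in> carrier_mat n mJ" "CJ \<in> carrier_mat qJ n"
    and rho: "\<rho> > 0"
    and X: "C1_sym_map (2 * n) Tmax X X'"
    and S_vars: "G \<in> carrier_mat n n" "H \<in> carrier_mat n n" "S \<in> carrier_mat n n"
      "GJ \<in> carrier_mat n n" "SJ \<in> carrier_mat n n"
    and KLMN: "K \<in> carrier_mat n n" "L \<in> carrier_mat n q"
      "M \<in> carrier_mat m n" "N \<in> carrier_mat m q"
    and KLMN_J: "KJ \<in> carrier_mat n n" "LJ \<in> carrier_mat n qJ"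
      "MJ \<in> carrier_mat mJ n" "NJ \<in> carrier_mat mJ qJ"
    and flow: "\<And>\<tau>. \<tau> \<in> {0..Tmax} \<Longrightarrow>
      (let bA = synth_A n m q A B C H G K L M N; bG = synth_G n H S G in
       pos_def (2 * n) (X \<tau>) \<and>
       neg_def (2 * n + 2 * n)
         (four_block_mat
            (X' \<tau> + bA\<^sup>T + bA)                (X \<tau> + \<rho> \<cdot>\<^sub>m bA\<^sup>T - bG)
            (X \<tau> + \<rho> \<cdot>\<^sub>m bA - bG\<^sup>T)   (- (\<rho> \<cdot>\<^sub>m (bG + bG\<^sup>T)))))"
    and jump: "\<And>\<tau>. \<tau> \<in> {Tmin..Tmax} \<Longrightarrow>
      (let bAJ = synth_A n mJ qJ AJ BJ CJ H GJ KJ LJ MJ NJ; bGJ = synth_G n H SJ GJ in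
       neg_def (2 * n + 2 * n)
         (four_block_mat
            (- X \<tau>)  (bAJ\<^sup>T)
            bAJ        (X 0 - bGJ - bGJ\<^sup>T)))"
  shows "\<exists>nc Ac Bc Cc Dc AcJ BcJ CcJ DcJ.
    0 < nc \<and>
    controller_mats nc q m Ac Bc Cc Dc \<and>
    controller_mats nc qJ mJ AcJ BcJ CcJ DcJ \<and>
    S_variable_LMIs_feasible (n + nc) Tmin Tmax
      (closed_loop_mat A B C Ac Bc Cc Dc)
      (closed_loop_mat AJ BJ CJ AcJ BcJ CcJ DcJ)"
proof -
  define P where "P = slack_transform n H"
  define Q :: "real mat" where "Q = four_block_mat H (1\<^sub>m n) (1\<^sub>m n) (0\<^sub>m n n)"
  define bG where "bG = synth_G n H S G"
  define bGJ where "bGJ = synth_G n H SJ GJ"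
  define bA where "bA = synth_A n m q A B C H G K L M N"
  define bAJ where "bAJ = synth_A n mJ qJ AJ BJ CJ H GJ KJ LJ MJ NJ"
  have c: "P \<in> carrier_mat (n + n) (n + n)" "bG \<in> carrier_mat (n + n) (n + n)"
    "bGJ \<in> carrier_mat (n + n) (n + n)" "bA \<in> carrier_mat (n + n) (n + n)"
    "bAJ \<in> carrier_mat (n + n) (n + n)" "Q \<in> carrier_mat (n + n) (n + n)"
    using S_vars plant KLMN KLMN_J
    by (auto simp: P_def bG_def bGJ_def bA_def bAJ_def Q_def synth_G_def synth_A_eq)
  have QP: "Q * P = 1\<^sub>m (n + n)"
    using slack_transform_left_inverse S_vars by (simp add: Q_def P_def)
  \<comment> \<open>The controller gets \<open>n\<close> states, so the dimension
    \<open>2 * n\<close> is written as \<open>n + n\<close>, in line with the blocks of plant and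
    controller.\<close>
  have X2: "C1_sym_map (n + n) Tmax X X'" using X by (simp add: mult_2)
  have Xc: "X \<tau> \<in> carrier_mat (n + n) (n + n)" "X' \<tau> \<in> carrier_mat (n + n) (n + n)"
    if "\<tau> \<in> {0..Tmax}" for \<tau>
    using X2 that by (auto simp: C1_sym_map_def sym_mats_def)
  have pos: "pos_def (n + n) (X \<tau>)"
    and flow': "neg_def ((n + n) + (n + n))
       (four_block_mat
          (X' \<tau> + bA\<^sup>T + bA)                (X \<tau> + \<rho> \<cdot>\<^sub>m bA\<^sup>T - bG)
          (X \<tau> + \<rho> \<cdot>\<^sub>m bA - bG\<^sup>T)   (- (\<rho> \<cdot>\<^sub>m (bG + bG\<^sup>T))))"
    if "\<tau> \<in> {0..Tmax}" for \<tau>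
    using flow[OF that] by (simp_all add: Let_def bA_def bG_def mult_2)
  have jump': "neg_def ((n + n) + (n + n))
       (four_block_mat (- X \<tau>) (bAJ\<^sup>T) bAJ (X 0 - bGJ - bGJ\<^sup>T))"
    if "\<tau> \<in> {Tmin..Tmax}" for \<tau>
    using jump[OF that] by (simp add: Let_def bAJ_def bGJ_def mult_2)
  \<comment> \<open>The slack matrices are constant, so one instant each is enough for their
    nonsingularity: 0 for the flow and \<open>Tmin\<close> for the jump.\<close>
  have mem: "0 \<in> {0..Tmax}" "Tmin \<in> {Tmin..Tmax}" "Tmin \<in> {0..Tmax}" using T by auto
  \<comment> \<open>Moving the transpose across the scalar product gives (M w) . w. Hence the form
    of M + M^T vanishes on the kernel of \<open>M\<close>.\<close>
  have transpose0: "w \<bullet> (M\<^sup>T *\<^sub>v w) = 0"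
    if "M \<in> carrier_mat (n + n) (n + n)" "w \<in> carrier_vec (n + n)" "M *\<^sub>v w = 0\<^sub>v (n + n)"
    for M :: "real mat" and w
    using transpose_vec_mult_scalar[OF that(1,2,2)] that
      comm_scalar_prod[of w "n + n" "M\<^sup>T *\<^sub>v w"] by simp
  \<comment> \<open>At a kernel vector the lower right block of the flow LMI would have value 0
    instead of a negative one.\<close>
  have nzG: "bG *\<^sub>v w \<noteq> 0\<^sub>v (n + n)" if w: "w \<in> carrier_vec (n + n)" "w \<noteq> 0\<^sub>v (n + n)" for w
  proof
    assume 0: "bG *\<^sub>v w = 0\<^sub>v (n + n)"
    have "w \<bullet> ((- (\<rho> \<cdot>\<^sub>m (bG + bG\<^sup>T))) *\<^sub>v w) < 0"
      by (rule neg_def_lower_right_block[OF flow'[OF mem(1)]]) (use c Xc[OF mem(1)] w in auto)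
    also have "(- (\<rho> \<cdot>\<^sub>m (bG + bG\<^sup>T))) *\<^sub>v w = (- \<rho>) \<cdot>\<^sub>v (bG *\<^sub>v w + bG\<^sup>T *\<^sub>v w)"
    proof -
      have "- (\<rho> \<cdot>\<^sub>m (bG + bG\<^sup>T)) = (- \<rho>) \<cdot>\<^sub>m (bG + bG\<^sup>T)" by (intro eq_matI) auto
      then show ?thesis
        using c w by (simp add: smult_mult_mat_vec[of _ "n + n" "n + n"] add_mult_distrib_mat_vec[of _ "n + n" "n + n"])
    qed
    also have "w \<bullet> \<dots> = 0"
      using c w transpose0[OF c(2) w(1) 0] 0 by (simp add: scalar_prod_smult_right)
    finally show False by simp
  qed
  \<comment> \<open>At a kernel vector only the term of \<open>X 0\<close> would remain in the lower
    right block, and it is positive.\<close>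
  have nzGJ: "bGJ *\<^sub>v w \<noteq> 0\<^sub>v (n + n)" if w: "w \<in> carrier_vec (n + n)" "w \<noteq> 0\<^sub>v (n + n)" for w
  proof
    assume 0: "bGJ *\<^sub>v w = 0\<^sub>v (n + n)"
    have "w \<bullet> ((X 0 - bGJ - bGJ\<^sup>T) *\<^sub>v w) < 0"
      by (rule neg_def_lower_right_block[OF jump'[OF mem(2)]])
        (use c Xc[OF mem(1)] Xc[OF mem(3)] w in auto)
    also have "(X 0 - bGJ - bGJ\<^sup>T) *\<^sub>v w = X 0 *\<^sub>v w - bGJ *\<^sub>v w - bGJ\<^sup>T *\<^sub>v w"
      using c w Xc[OF mem(1)] minus_mult_distrib_mat_vec[of "X 0" "n + n" "n + n" bGJ w]
        minus_mult_distrib_mat_vec[of "X 0 - bGJ" "n + n" "n + n" "bGJ\<^sup>T" w]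
        minus_carrier_mat[OF c(3), of "X 0"]
      by simp
    also have "w \<bullet> \<dots> = w \<bullet> (X 0 *\<^sub>v w)"
      using c w Xc[OF mem(1)] transpose0[OF c(3) w(1) 0] 0
      by (simp add: scalar_prod_minus_distrib[of _ "n + n"])
    finally show False using pos[OF mem(1)] w by (auto simp: pos_def_def)
  qed
  obtain Ac Bc Cc Dc where ctrl: "controller_mats n q m Ac Bc Cc Dc"
    and GA: "congruence P bG * closed_loop_mat A B C Ac Bc Cc Dc = congruence P bA"
    using controller_reconstruction[OF plant(1-3) S_vars(1-3) KLMN] nzG
    unfolding P_def bG_def bA_def by blast
  \<comment> \<open>\<open>GJ\<close> and \<open>SJ\<close> replace \<open>G\<close> and
    \<open>S\<close>, while \<open>H\<close> stays, so the same \<open>P\<close> appears.\<close>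
  obtain AcJ BcJ CcJ DcJ where ctrlJ: "controller_mats n qJ mJ AcJ BcJ CcJ DcJ"
    and GAJ: "congruence P bGJ * closed_loop_mat AJ BJ CJ AcJ BcJ CcJ DcJ = congruence P bAJ"
    using controller_reconstruction[OF plant(4-6) S_vars(4,2,5) KLMN_J] nzGJ
    unfolding P_def bGJ_def bAJ_def by blast
  let ?Acl = "closed_loop_mat A B C Ac Bc Cc Dc"
  let ?AclJ = "closed_loop_mat AJ BJ CJ AcJ BcJ CcJ DcJ"
  have cl: "?Acl \<in> carrier_mat (n + n) (n + n)" "?AclJ \<in> carrier_mat (n + n) (n + n)"
    using plant ctrl ctrlJ by (auto simp: closed_loop_mat_def controller_mats_def)
  have GAt: "?Acl\<^sup>T * (congruence P bG)\<^sup>T = congruence P bA\<^sup>T"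
    using GA cl c congruence_simps(5)[OF c(1,4,4)]
    by (simp flip: transpose_mult[of _ "n + n" "n + n" _ "n + n"])
  have GAJt: "?AclJ\<^sup>T * (congruence P bGJ)\<^sup>T = congruence P bAJ\<^sup>T"
    using GAJ cl c congruence_simps(5)[OF c(1,5,5)]
    by (simp flip: transpose_mult[of _ "n + n" "n + n" _ "n + n"])
  \<comment> \<open>Sums and scalars are moved out of the congruence and transposes into it, so that
    the transformed blocks and the closed-loop blocks reach a common form.\<close>
  note congr = congruence_simps(1-4)[of P "n + n"] congruence_simps(5)[OF c(1), symmetric]
  have flow_cl: "neg_def ((n + n) + (n + n))
     (four_block_mat
        (congruence P (X' \<tau>) + ?Acl\<^sup>T * (congruence P bG)\<^sup>T + congruence P bG * ?Acl)
        (congruence P (X \<tau>) + \<rho> \<cdot>\<^sub>m (?Acl\<^sup>T * (congruence P bG)\<^sup>T) - congruence P bG)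
        (congruence P (X \<tau>) + \<rho> \<cdot>\<^sub>m (congruence P bG * ?Acl) - (congruence P bG)\<^sup>T)
        (- (\<rho> \<cdot>\<^sub>m (congruence P bG + (congruence P bG)\<^sup>T))))"
    if \<tau>: "\<tau> \<in> {0..Tmax}" for \<tau>
    using neg_def_block_congruence[OF c(1,6) QP _ _ _ _ flow'[OF \<tau>]] c Xc[OF \<tau>]
      minus_carrier_mat[OF c(2), of "X \<tau> + \<rho> \<cdot>\<^sub>m bA\<^sup>T"]
      minus_carrier_mat[of "bG\<^sup>T" "n + n" "n + n" "X \<tau> + \<rho> \<cdot>\<^sub>m bA"]
    unfolding GA GAt by (simp add: congr assoc_add_mat[of _ "n + n" "n + n"])
  have jump_cl: "neg_def ((n + n) + (n + n))
     (four_block_mat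
        (- congruence P (X \<tau>)) (?AclJ\<^sup>T * (congruence P bGJ)\<^sup>T)
        (congruence P bGJ * ?AclJ)
        (congruence P (X 0) - congruence P bGJ - (congruence P bGJ)\<^sup>T))"
    if \<tau>: "\<tau> \<in> {Tmin..Tmax}" for \<tau>
  proof -
    have "\<tau> \<in> {0..Tmax}" using \<tau> T by auto
    from neg_def_block_congruence[OF c(1,6) QP _ _ _ _ jump'[OF \<tau>]] c Xc[OF this] Xc[OF mem(1)]
      minus_carrier_mat[OF c(3), of "X 0"]
      minus_carrier_mat[of "bGJ\<^sup>T" "n + n" "n + n" "X 0 - bGJ"]
    show ?thesis unfolding GAJ GAJt by (simp add: congr)
  qed
  \<comment> \<open>The scalar \<open>\<rho>\<close> is kept; the Lyapunov map, its derivative and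
    both slack matrices are replaced by their congruences.\<close>
  have "S_variable_LMIs_feasible (n + n) Tmin Tmax ?Acl ?AclJ"
    unfolding S_variable_LMIs_feasible_def
    using C1_sym_map_congruence[OF X2 c(1)] rho c pos_def_congruence[OF c(1,6) QP pos]
      flow_cl jump_cl
    by (intro exI[of _ "\<lambda>\<tau>. congruence P (X \<tau>)"] exI[of _ "\<lambda>\<tau>. congruence P (X' \<tau>)"]
        exI[of _ \<rho>] exI[of _ "congruence P bG"] exI[of _ "congruence P bGJ"]) simp
  with n ctrl ctrlJ show ?thesis by blast
qed

end
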